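(* Let $(\mathfrak{L},[\;,\;])$ be a complex simple finite-dimensional Lie superalgebra. Then there are no non-trivial transposed Poisson superalgebra structures defined on $\mathfrak{L}$.
   Context: A transposed Poisson superalgebra structure on a complex Lie superalgebra $(\mathfrak{L}=\mathfrak{L}_0\oplus\mathfrak{L}_1,[\;,\;])$ is a bilinear operation $\cdot$ on $\mathfrak{L}$, compatible with the $\mathbb{Z}_2$-grading, such that $(\mathfrak{L},\cdot)$ is a supercommutative associative superalgebra (not necessarily unital) and $2z\cdot[x,y]=[z\cdot x,y]+(-1)^{|x||z|}[x,z\cdot y]$ for all homogeneous $x,y,z\in\mathfrak{L}_0\cup\mathfrak{L}_1$, where $|x|$ denotes the parity of $x$. The structure is non-trivial if both operations $\cdot$ and $[\;,\;]$ are not identically zero. *)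

theory Defs
  imports Complex_Main "HOL-Library.Z2"
begin

text \<open>
  The underlying space of a superalgebra is a whole type, with an explicit complex scalar
  multiplication. Parities are elements of the two-element field \<open>bit\<close>, so that
  parities add modulo 2.
\<close>

locale super_vector_space = vector_space scale
  for scale :: "complex \<Rightarrow> 'a::ab_group_add \<Rightarrow> 'a" +
  fixes gr :: "bit \<Rightarrow> 'a set"
  assumes subspace_gr: "subspace (gr i)"
    and gr_Int: "gr 0 \<inter> gr 1 = {0}"
    and gr_sum: "\<exists>x\<in>gr 0. \<exists>y\<in>gr 1. z = x + y"

text \<open>The sign \<open>(-1)\<close> to the power \<open>i j\<close> for parities \<open>i\<close> and \<open>j\<close>.\<close>

definition super_sign :: "bit \<Rightarrow> bit \<Rightarrow> complex" where
  "super_sign i j = (if i * j = 1 then - 1 else 1)"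

locale superalgebra = super_vector_space scale gr
  for scale :: "complex \<Rightarrow> 'a::ab_group_add \<Rightarrow> 'a" and gr :: "bit \<Rightarrow> 'a set" +
  fixes mult :: "'a \<Rightarrow> 'a \<Rightarrow> 'a"
  assumes linear_left: "Vector_Spaces.linear scale scale (\<lambda>x. mult x y)"
    and linear_right: "Vector_Spaces.linear scale scale (\<lambda>y. mult x y)"
    and mult_gr: "x \<in> gr i \<Longrightarrow> y \<in> gr j \<Longrightarrow> mult x y \<in> gr (i + j)"
begin

text \<open>
  Ideals of a superalgebra are graded: they contain the homogeneous components of their elements.
\<close>

definition graded_ideal :: "'a set \<Rightarrow> bool" where
  "graded_ideal I \<longleftrightarrow>
     subspace I \<and>
     (\<forall>x\<in>gr 0. \<forall>y\<in>gr 1. x + y \<in> I \<longrightarrow> x \<in> I \<and> y \<in> I) \<and>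
     (\<forall>x. \<forall>y\<in>I. mult x y \<in> I \<and> mult y x \<in> I)"

end

locale lie_superalgebra = superalgebra scale gr bracket
  for scale :: "complex \<Rightarrow> 'a::ab_group_add \<Rightarrow> 'a" and gr :: "bit \<Rightarrow> 'a set"
    and bracket :: "'a \<Rightarrow> 'a \<Rightarrow> 'a" +
  assumes super_skew_symmetric:
      "x \<in> gr i \<Longrightarrow> y \<in> gr j \<Longrightarrow>
        bracket x y = - scale (super_sign i j) (bracket y x)"
    and super_jacobi:
      "x \<in> gr i \<Longrightarrow> y \<in> gr j \<Longrightarrow> z \<in> gr k \<Longrightarrow>
        bracket x (bracket y z) =
          bracket (bracket x y) z + scale (super_sign i j) (bracket y (bracket x z))"

locale simple_lie_superalgebra = lie_superalgebra scale gr bracket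
  for scale :: "complex \<Rightarrow> 'a::ab_group_add \<Rightarrow> 'a" and gr :: "bit \<Rightarrow> 'a set"
    and bracket :: "'a \<Rightarrow> 'a \<Rightarrow> 'a" +
  assumes not_abelian: "\<exists>x y. bracket x y \<noteq> 0"
    and graded_ideal_trivial: "graded_ideal I \<Longrightarrow> I = {0} \<or> I = UNIV"

locale supercommutative_associative_superalgebra = superalgebra scale gr dot
  for scale :: "complex \<Rightarrow> 'a::ab_group_add \<Rightarrow> 'a" and gr :: "bit \<Rightarrow> 'a set"
    and dot :: "'a \<Rightarrow> 'a \<Rightarrow> 'a" +
  assumes associative: "dot (dot x y) z = dot x (dot y z)"
    and supercommutative:
      "x \<in> gr i \<Longrightarrow> y \<in> gr j \<Longrightarrow> dot x y = scale (super_sign i j) (dot y x)"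

locale transposed_poisson_superalgebra =
  lie_superalgebra scale gr bracket +
  dot: supercommutative_associative_superalgebra scale gr dot
  for scale :: "complex \<Rightarrow> 'a::ab_group_add \<Rightarrow> 'a" and gr :: "bit \<Rightarrow> 'a set"
    and bracket :: "'a \<Rightarrow> 'a \<Rightarrow> 'a" and dot :: "'a \<Rightarrow> 'a \<Rightarrow> 'a" +
  assumes transposed_leibniz:
    "x \<in> gr i \<Longrightarrow> y \<in> gr j \<Longrightarrow> z \<in> gr k \<Longrightarrow>
      scale 2 (dot z (bracket x y)) =
        bracket (dot z x) y + scale (super_sign i k) (bracket x (dot z y))"

definition nontrivial_structure :: "('a::zero \<Rightarrow> 'a \<Rightarrow> 'a) \<Rightarrow> ('a \<Rightarrow> 'a \<Rightarrow> 'a) \<Rightarrow> bool" where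
  "nontrivial_structure bracket dot \<longleftrightarrow>
     (\<exists>x y. dot x y \<noteq> 0) \<and> (\<exists>x y. bracket x y \<noteq> 0)"

end

theory Submission
  imports Defs "HOL-Computational_Algebra.Fundamental_Theorem_Algebra"
begin

text \<open>
  Multiplication by a homogeneous element \<open>z\<close> of a transposed Poisson superalgebra is a
  superderivation with multiplier \<open>1/2\<close>: a homogeneous linear map \<open>f\<close> with
  \<open>f [x, y] = 1/2 ([f x, y] \<plusminus> [x, f y])\<close>. The theorem follows once every such map on a simple
  finite-dimensional Lie superalgebra \<open>L\<close> is known to be a scalar if it is even and zero if it is
  odd. Then \<open>z \<cdot> w\<close> is a multiple of \<open>w\<close> and, by supercommutativity, of \<open>z\<close>; a non-zero product
  would force \<open>L\<close> to be spanned by one even element and hence to be abelian. The proof below does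
  not go through the classification of simple Lie superalgebras. It rests on four ideas,
  stated for superderivations with an arbitrary multiplier \<open>d\<close>.

  Eigenvalues. For an even \<open>f\<close>, bracketing sends the generalized eigenspaces for \<open>s\<close> and \<open>t\<close> to
  the one for \<open>d (s + t)\<close>. Let \<open>a\<close> be an eigenvalue of largest modulus. If \<open>d = 1/2\<close> then \<open>a\<close> is an
  extreme point of a disc that contains the spectrum, so the sum of the other generalized
  eigenspaces is an ideal. It is proper, so it vanishes, and \<open>f - a\<close> is nilpotent. If \<open>d = 1/2^k\<close>
  with \<open>k \<ge> 2\<close>, the same argument applies and moreover \<open>a = 0\<close>
  (\<open>even_superderivation_single_root\<close>).

  Small multipliers. Since \<open>L\<close> is spanned by brackets, the rule for \<open>f [x, y]\<close> bounds the size of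
  \<open>f\<close> by \<open>|d|\<close> times a constant times the size of \<open>f\<close>, so \<open>f = 0\<close> when \<open>|d|\<close> is small
  (\<open>superderivation_small_multiplier\<close>).

  Common kernels. A supercommuting family of nilpotent operators on a non-zero space has a non-zero
  common kernel. If the family is stable under supercommutators with all \<open>ad x\<close>, this kernel is
  an ideal, so it is everything and the family is zero
  (\<open>stable_supercommuting_family_zero\<close>).

  Supercommutators. The supercommutator of superderivations with multipliers \<open>d\<close> and \<open>e\<close> has
  multiplier \<open>d e\<close>. So if all superderivations with multiplier \<open>1/2^j\<close>, \<open>j > k\<close>, vanish, those with
  multiplier \<open>1/2^k\<close> supercommute, and for \<open>k \<ge> 2\<close> they are nilpotent; descending induction from
  the small multipliers shows that they all vanish for \<open>k \<ge> 2\<close>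
  (\<open>superderivation_half_power_zero\<close>). Consequently superderivations with multiplier \<open>1/2\<close>
  supercommute. The nilpotent ones among them form a family that is stable under \<open>ad\<close>: otherwise
  some supercommutator \<open>[ad x, f]\<close> with \<open>f\<close> nilpotent would be bijective, which
  \<open>even_commutator_not_injective\<close> and \<open>odd_supercommutator_not_injective\<close> exclude. So they vanish
  too. For even \<open>f\<close> this applies to the nilpotent map \<open>f - a\<close>, and odd \<open>f\<close> have square zero.
\<close>

section \<open>Root spaces of an operator\<close>

locale complex_fd_space = finite_dimensional_vector_space scale Basis
  for scale :: "complex \<Rightarrow> 'a::ab_group_add \<Rightarrow> 'a" and Basis :: "'a set"
begin

abbreviation linear_op :: "('a \<Rightarrow> 'a) \<Rightarrow> bool" where
  "linear_op \<equiv> Vector_Spaces.linear scale scale"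

lemma linear_opI:
  assumes "\<And>x y. f (x + y) = f x + f y" "\<And>c x. f (scale c x) = scale c (f x)"
  shows "linear_op f"
  using assms vector_space_axioms by (simp add: Vector_Spaces.linear_iff)

lemma linear_opD:
  assumes "linear_op f"
  shows "f (x + y) = f x + f y" "f (scale c x) = scale c (f x)" "f 0 = 0" "f (- x) = - f x"
    "f (x - y) = f x - f y"
proof -
  interpret f: Vector_Spaces.linear scale scale f by (fact assms)
  show "f (x + y) = f x + f y" "f (scale c x) = scale c (f x)" "f 0 = 0" "f (- x) = - f x"
    "f (x - y) = f x - f y"
    by (simp_all add: f.add f.scale f.neg f.diff)
qed

lemma linear_op_funpow: "linear_op f \<Longrightarrow> linear_op (f ^^ n)"
  by (induction n) (auto intro!: linear_opI simp: linear_opD)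

text \<open>
  The operator \<open>f - c\<close>; products of such operators are written as folds over the list of
  the scalars \<open>c\<close>.
\<close>

definition shift :: "('a \<Rightarrow> 'a) \<Rightarrow> complex \<Rightarrow> 'a \<Rightarrow> 'a" where
  "shift f c x = f x - scale c x"

text \<open>
  For a finite-dimensional space this is the sum of the generalized eigenspaces for the eigenvalues
  in \<open>S\<close>. Working with lists of linear factors makes the behaviour under brackets provable by
  induction, without a decomposition into eigenspaces.
\<close>

definition root_space :: "('a \<Rightarrow> 'a) \<Rightarrow> complex set \<Rightarrow> 'a set" where
  "root_space f S = {x. \<exists>cs. set cs \<subseteq> S \<and> fold (shift f) cs x = 0}"

lemma linear_op_shift: "linear_op f \<Longrightarrow> linear_op (shift f c)"
  by (rule linear_opI) (simp_all add: shift_def linear_opD algebra_simps)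

lemma linear_op_fold_shift: "linear_op f \<Longrightarrow> linear_op (fold (shift f) cs)"
proof (induction cs)
  case Nil
  then show ?case by (auto intro: linear_opI)
next
  case (Cons c cs)
  show ?case
    using linear_opD[OF Cons.IH[OF Cons.prems]] linear_opD[OF linear_op_shift[OF Cons.prems, of c]]
    by (intro linear_opI) auto
qed

lemma shift_commute: "linear_op f \<Longrightarrow> shift f c (shift f d x) = shift f d (shift f c x)"
  by (simp add: shift_def linear_opD algebra_simps)

lemma fold_shift_commute:
  "linear_op f \<Longrightarrow> fold (shift f) cs (shift f d x) = shift f d (fold (shift f) cs x)"
proof (induction cs arbitrary: x)
  case (Cons c cs)
  show ?case
    using Cons.IH[OF Cons.prems, of "shift f c x"] by (simp add: shift_commute[OF Cons.prems, of c d])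
qed simp

lemma fold_shift_append_commute:
  "linear_op f \<Longrightarrow> fold (shift f) cs (fold (shift f) ds x) = fold (shift f) ds (fold (shift f) cs x)"
  by (induction ds arbitrary: x) (simp_all add: fold_shift_commute)

lemma fold_shift_partition:
  "linear_op f \<Longrightarrow> fold (shift f) cs x =
     fold (shift f) (filter (\<lambda>c. \<not> P c) cs) (fold (shift f) (filter P cs) x)"
proof (induction cs arbitrary: x)
  case (Cons c cs)
  show ?case
    using Cons.IH[OF Cons.prems, of "shift f c x"]
    by (simp add: fold_shift_commute[OF Cons.prems])
qed simp

lemma fold_shift_eigenvector:
  assumes "linear_op f" "f v = scale a v"
  shows "fold (shift f) cs v = scale (\<Prod>c\<leftarrow>cs. a - c) v"
proof (induction cs)
  case (Cons c cs)
  have "shift f c v = scale (a - c) v"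
    by (simp add: shift_def assms(2) algebra_simps)
  then show ?case
    using Cons.IH linear_opD(2)[OF linear_op_fold_shift[OF assms(1)]] by (simp add: mult.commute)
qed simp

text \<open>
  A product of factors \<open>f - c\<close> acts on an eigenvector for \<open>a\<close> as the product of the \<open>a - c\<close>, which
  vanishes only if \<open>a\<close> is one of the \<open>c\<close>.
\<close>

lemma eigenvalue_in_root_set:
  assumes "linear_op f" "f v = scale a v" "v \<noteq> 0" "v \<in> root_space f S"
  shows "a \<in> S"
proof -
  obtain cs where "set cs \<subseteq> S" "fold (shift f) cs v = 0"
    using assms(4) unfolding root_space_def by blast
  then show ?thesis
    using fold_shift_eigenvector[OF assms(1,2), of cs] assms(3) by (auto simp: prod_list_zero_iff)
qed

lemma root_space_shift:
  assumes "shift f c x \<in> root_space f S" "c \<in> S"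
  shows "x \<in> root_space f S"
proof -
  obtain cs where "set cs \<subseteq> S" "fold (shift f) cs (shift f c x) = 0"
    using assms(1) unfolding root_space_def by blast
  then show ?thesis
    unfolding root_space_def using assms(2) by (intro CollectI exI[of _ "c # cs"]) auto
qed

lemma zero_in_root_space: "0 \<in> root_space f S"
  unfolding root_space_def by (intro CollectI exI[of _ "[]"]) auto

text \<open>
  The factors commute, so the concatenation of a list that kills \<open>x\<close> with one that kills \<open>y\<close> kills
  both.
\<close>

lemma subspace_root_space:
  assumes "linear_op f"
  shows "subspace (root_space f S)"
proof (rule subspaceI)
  show "0 \<in> root_space f S" by (rule zero_in_root_space)
next
  fix x y assume "x \<in> root_space f S" "y \<in> root_space f S"
  then obtain cs ds where "set cs \<subseteq> S" "fold (shift f) cs x = 0" "set ds \<subseteq> S" "fold (shift f) ds y = 0"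
    unfolding root_space_def by blast
  moreover have "fold (shift f) ds (fold (shift f) cs (x + y))
      = fold (shift f) ds (fold (shift f) cs x) + fold (shift f) cs (fold (shift f) ds y)"
    using assms by (simp add: linear_opD(1)[OF linear_op_fold_shift] fold_shift_append_commute)
  ultimately show "x + y \<in> root_space f S"
    unfolding root_space_def using linear_opD(3)[OF linear_op_fold_shift[OF assms]]
    by (intro CollectI exI[of _ "cs @ ds"]) auto
next
  fix c x assume "x \<in> root_space f S"
  then show "scale c x \<in> root_space f S"
    unfolding root_space_def using linear_opD(2)[OF linear_op_fold_shift[OF assms]] by auto
qed

definition nilpotent_op :: "('a \<Rightarrow> 'a) \<Rightarrow> bool" where
  "nilpotent_op f \<longleftrightarrow> (\<exists>n. \<forall>x. (f ^^ n) x = 0)"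

text \<open>
  The last non-zero vector in the sequence \<open>x, f x, f (f x), \<dots>\<close> lies in the kernel.
\<close>

lemma nilpotent_op_kernel:
  assumes "nilpotent_op f" "x \<in> U" "x \<noteq> 0" "\<And>u. u \<in> U \<Longrightarrow> f u \<in> U"
  shows "\<exists>u\<in>U. u \<noteq> 0 \<and> f u = 0"
proof -
  define n where "n = (LEAST n. (f ^^ n) x = 0)"
  have ex: "\<exists>n. (f ^^ n) x = 0" using assms(1) unfolding nilpotent_op_def by blast
  have n: "(f ^^ n) x = 0" unfolding n_def by (rule LeastI_ex[OF ex])
  then obtain m where m: "n = Suc m" using assms(3) by (cases n) auto
  have nz: "(f ^^ m) x \<noteq> 0"
    using not_less_Least[of m "\<lambda>n. (f ^^ n) x = 0"] m unfolding n_def by auto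
  have "(f ^^ m) x \<in> U" by (induction m) (auto intro: assms)
  then show ?thesis using n m nz by auto
qed


definition poly_op :: "complex poly \<Rightarrow> ('a \<Rightarrow> 'a) \<Rightarrow> 'a \<Rightarrow> 'a" where
  "poly_op p f x = (\<Sum>i\<le>degree p. scale (coeff p i) ((f ^^ i) x))"

lemma poly_op_bound:
  assumes "degree p \<le> n"
  shows "poly_op p f x = (\<Sum>i\<le>n. scale (coeff p i) ((f ^^ i) x))"
  unfolding poly_op_def using assms
  by (intro sum.mono_neutral_left) (auto simp: coeff_eq_0)

lemma poly_op_linear_factor:
  assumes "linear_op f"
  shows "poly_op ([:- a, 1:] * q) f x = poly_op q f (shift f a x)"
proof -
  let ?n = "degree q"
  have pow: "(f ^^ i) (shift f a x) = (f ^^ Suc i) x - scale a ((f ^^ i) x)" for i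
    by (simp add: shift_def linear_opD[OF linear_op_funpow[OF assms]] funpow_swap1)
  have "[:- a, 1:] * q = pCons 0 q - smult a q" by simp
  then have c: "coeff ([:- a, 1:] * q) i = coeff (pCons 0 q) i - a * coeff q i" for i
    by simp
  have "degree ([:- a, 1:] * q) \<le> Suc ?n"
    using degree_mult_le[of "[:- a, 1:]" q] by auto
  then have "poly_op ([:- a, 1:] * q) f x
      = (\<Sum>i\<le>Suc ?n. scale (coeff (pCons 0 q) i - a * coeff q i) ((f ^^ i) x))"
    using c by (simp add: poly_op_bound)
  also have "\<dots> = (\<Sum>i\<le>Suc ?n. scale (coeff (pCons 0 q) i) ((f ^^ i) x))
      - (\<Sum>i\<le>Suc ?n. scale (a * coeff q i) ((f ^^ i) x))"
    by (simp only: scale_left_diff_distrib sum_subtractf)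
  also have "(\<Sum>i\<le>Suc ?n. scale (coeff (pCons 0 q) i) ((f ^^ i) x))
      = (\<Sum>i\<le>?n. scale (coeff q i) ((f ^^ Suc i) x))"
    by (subst sum.atMost_Suc_shift) (simp add: coeff_pCons_0 del: funpow.simps)
  also have "(\<Sum>i\<le>Suc ?n. scale (a * coeff q i) ((f ^^ i) x))
      = (\<Sum>i\<le>?n. scale (coeff q i) (scale a ((f ^^ i) x)))"
    by (simp add: coeff_eq_0 mult.commute)
  finally show ?thesis
    by (simp add: poly_op_def pow scale_right_diff_distrib sum_subtractf del: funpow.simps)
qed

text \<open>
  Over the complex numbers a polynomial splits into linear factors, which are split off one by one.
\<close>

lemma poly_op_zero_imp_roots:
  assumes "linear_op f" "p \<noteq> 0" "poly_op p f x = 0"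
  shows "\<exists>cs. fold (shift f) cs x = 0"
  using assms(2,3)
proof (induction "degree p" arbitrary: p x)
  case 0
  then have "coeff p 0 \<noteq> 0" by (metis leading_coeff_0_iff)
  moreover have "scale (coeff p 0) x = 0" using 0 by (simp add: poly_op_def)
  ultimately have "x = 0" by simp
  then show ?case by (intro exI[of _ "[]"]) auto
next
  case (Suc n)
  then obtain a where "poly p a = 0"
    using fundamental_theorem_of_algebra[of p] by (auto simp: constant_degree)
  then obtain q where q: "p = [:- a, 1:] * q"
    by (auto simp: poly_eq_0_iff_dvd)
  then have "q \<noteq> 0" using Suc.prems by auto
  then have "degree p = Suc (degree q)" unfolding q by (subst degree_mult_eq) auto
  then obtain cs where "fold (shift f) cs (shift f a x) = 0"
    using Suc.hyps \<open>q \<noteq> 0\<close> Suc.prems(2) poly_op_linear_factor[OF assms(1)] q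
    by (metis old.nat.inject)
  then show ?case by (intro exI[of _ "a # cs"]) simp
qed

text \<open>
  The iterates of \<open>f\<close> at \<open>x\<close>, taken up to the dimension, satisfy a linear relation: either two of
  them coincide, or they are more distinct vectors than an independent set can have.
\<close>

lemma annihilating_poly:
  shows "\<exists>p. p \<noteq> 0 \<and> poly_op p f x = 0"
proof -
  define v where "v = (\<lambda>i. (f ^^ i) x)"
  define N where "N = Suc (card Basis)"
  show ?thesis
  proof (cases "inj_on v {..<N}")
    case True
    have "card (v ` {..<N}) > card Basis" using card_image[OF True] by (simp add: N_def)
    then have "dependent (v ` {..<N})"
      using independent_card_le_dim[of "v ` {..<N}" UNIV] by auto
    then obtain u i where u: "i < N" "u (v i) \<noteq> 0" "(\<Sum>w\<in>v ` {..<N}. scale (u w) w) = 0"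
      by (subst (asm) dependent_finite) auto
    define p where "p = Poly (map (u \<circ> v) [0..<N])"
    have c: "coeff p j = (if j < N then u (v j) else 0)" for j
      by (auto simp: p_def nth_default_def)
    have "coeff p i \<noteq> 0" using u c by simp
    then have "p \<noteq> 0" by auto
    moreover have "degree p \<le> card Basis"
      by (rule degree_le) (auto simp: c N_def)
    then have "poly_op p f x = (\<Sum>j\<in>{..<N}. scale (u (v j)) (v j))"
      by (subst poly_op_bound) (auto simp: c v_def N_def lessThan_Suc_atMost intro!: sum.cong)
    then have "poly_op p f x = 0"
      using u(3) by (simp add: sum.reindex[OF True])
    ultimately show ?thesis by blast
  next
    case False
    then obtain i' j' where "i' \<noteq> j'" "v i' = v j'" by (auto simp: inj_on_def)
    then obtain i j where ij: "i < j" "v i = v j" by (metis linorder_neqE_nat)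
    define p where "p = monom 1 j - monom (1::complex) i"
    have c: "coeff p k = (if k = j then 1 else if k = i then - 1 else 0)" for k
      using ij by (auto simp: p_def)
    have "coeff p j \<noteq> 0" by (simp add: c)
    then have p0: "p \<noteq> 0" by auto
    have "degree p \<le> j" using ij by (intro degree_le) (auto simp: c)
    then have "poly_op p f x = (\<Sum>k\<le>j. scale (if k = j then 1 else if k = i then - 1 else 0) (v k))"
      by (subst poly_op_bound) (simp_all add: c v_def)
    also have "\<dots> = (\<Sum>k\<in>{i, j}. scale (if k = j then 1 else if k = i then - 1 else 0) (v k))"
      using ij by (intro sum.mono_neutral_right) auto
    also have "\<dots> = 0" using ij by auto
    finally show ?thesis using p0 by blast
  qed
qed

lemma annihilating_list:
  assumes "linear_op f"
  shows "\<exists>cs. \<forall>x. fold (shift f) cs x = 0"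
proof -
  have "\<exists>cs. fold (shift f) cs b = 0" for b
    using annihilating_poly poly_op_zero_imp_roots[OF assms] by blast
  then obtain g where g: "\<And>b. fold (shift f) (g b) b = 0" by metis
  obtain bs where bs: "set bs = Basis" using finite_list[OF finite_Basis] by blast
  define cs where "cs = concat (map g bs)"
  have *: "fold (shift f) (concat (map g bs)) b = 0" if "b \<in> set bs" for bs b
    using that
  proof (induction bs)
    case (Cons d bs)
    note lin = linear_opD(3)[OF linear_op_fold_shift[OF assms]]
    show ?case
    proof (cases "b = d")
      case False
      then show ?thesis using Cons lin fold_shift_append_commute[OF assms]
        by (metis (no_types) comp_apply concat.simps(2) fold_append list.simps(9) set_ConsD)
    qed (simp add: g lin)
  qed simp
  have "fold (shift f) cs x = 0" for x
  proof -
    have "x \<in> span Basis" using span_Basis by simp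
    then show ?thesis
    proof (induction rule: span_induct)
      case base
      show ?case
        unfolding subspace_def using linear_opD[OF linear_op_fold_shift[OF assms]] by auto
    next
      case (step y)
      then show ?case using *[of y bs] bs by (simp add: cs_def)
    qed
  qed
  then show ?thesis by blast
qed

text \<open>
  In an annihilating list of least length every entry \<open>c\<close> is an eigenvalue: the remaining factors do
  not annihilate the space, and each non-zero value of their product is an eigenvector for \<open>c\<close>.
\<close>

lemma annihilating_list_of_eigenvalues:
  assumes "linear_op f"
  obtains cs where "\<And>x. fold (shift f) cs x = 0"
    and "\<And>c. c \<in> set cs \<Longrightarrow> \<exists>v. v \<noteq> 0 \<and> f v = scale c v"
proof -
  let ?P = "\<lambda>cs. \<forall>x. fold (shift f) cs x = 0"
  obtain cs where cs: "?P cs" and min: "\<And>ds. ?P ds \<Longrightarrow> length cs \<le> length ds"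
    using ex_has_least_nat[of ?P _ length] annihilating_list[OF assms] by metis
  have "\<exists>v. v \<noteq> 0 \<and> f v = scale c v" if c: "c \<in> set cs" for c
  proof -
    let ?ds = "remove1 c cs"
    have "length ?ds < length cs" using c by (simp add: length_remove1) (use length_pos_if_in_set[OF c] in linarith)
    then obtain x where x: "fold (shift f) ?ds x \<noteq> 0" using min[of ?ds] by auto
    obtain as bs where ab: "cs = as @ c # bs" "c \<notin> set as" using split_list_first[OF c] by blast
    then have "shift f c (fold (shift f) ?ds x) = fold (shift f) cs x"
      by (simp add: remove1_append fold_shift_commute[OF assms])
    then have "f (fold (shift f) ?ds x) = scale c (fold (shift f) ?ds x)"
      using cs by (simp add: shift_def)
    then show ?thesis using x by blast
  qed
  then show ?thesis using cs that by blast
qed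

text \<open>
  On a non-zero invariant subspace of least dimension every \<open>f \<in> W\<close> vanishes: its kernel there is
  non-zero by nilpotency and is again invariant, because \<open>W\<close> commutes up to scalars.
\<close>

lemma common_kernel:
  assumes lin: "\<And>f. f \<in> W \<Longrightarrow> linear_op f" and nil: "\<And>f. f \<in> W \<Longrightarrow> nilpotent_op f"
    and com: "\<And>f g. f \<in> W \<Longrightarrow> g \<in> W \<Longrightarrow> \<exists>c. \<forall>x. f (g x) = scale c (g (f x))"
    and nz: "\<exists>x::'a. x \<noteq> 0"
  shows "\<exists>v. v \<noteq> 0 \<and> (\<forall>f\<in>W. f v = 0)"
proof -
  define P where "P U \<longleftrightarrow> subspace U \<and> (\<exists>u\<in>U. u \<noteq> 0) \<and> (\<forall>f\<in>W. \<forall>u\<in>U. f u \<in> U)" for U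
  have "P UNIV" unfolding P_def using nz by auto
  then obtain U where "P U" and min: "\<And>U'. P U' \<Longrightarrow> dim U \<le> dim U'"
    using ex_has_least_nat[of P UNIV dim] by blast
  from \<open>P U\<close> have U: "subspace U" "\<exists>u\<in>U. u \<noteq> 0" "\<And>f u. f \<in> W \<Longrightarrow> u \<in> U \<Longrightarrow> f u \<in> U"
    unfolding P_def by blast+
  have "f u = 0" if f: "f \<in> W" and u: "u \<in> U" for f u
  proof -
    let ?K = "{u \<in> U. f u = 0}"
    have "subspace ?K"
      using U(1) unfolding subspace_def by (auto simp: linear_opD[OF lin[OF f]])
    moreover have "\<exists>u\<in>?K. u \<noteq> 0"
      using nilpotent_op_kernel[OF nil[OF f], of _ U] U(2,3) f by blast
    moreover have "g u \<in> ?K" if g: "g \<in> W" and u: "u \<in> ?K" for g u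
    proof -
      obtain c where "\<And>x. f (g x) = scale c (g (f x))" using com[OF f g] by blast
      then have "f (g u) = 0" using u linear_opD(3)[OF lin[OF g]] by simp
      then show ?thesis using U(3) g u by simp
    qed
    ultimately have "dim U \<le> dim ?K" using min[of ?K] unfolding P_def by blast
    then have "?K = U"
      using \<open>subspace ?K\<close> U(1) by (intro subspace_dim_equal) auto
    then show ?thesis using u by blast
  qed
  then show ?thesis using U(2) by blast
qed

end

section \<open>Superderivations\<close>

text \<open>
  Discs are strictly convex: a boundary point \<open>a\<close> is the midpoint of two points of the disc only if
  both equal \<open>a\<close>. This is the parallelogram law.
\<close>

lemma complex_midpoint_extreme:
  fixes a s t :: complex
  assumes "norm s \<le> norm a" "norm t \<le> norm a" "s + t = 2 * a"
  shows "s = a"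
proof -
  define d where "d = s - a"
  have st: "s = a + d" "t = a - d" using assms(3) by (auto simp: d_def algebra_simps)
  have "(norm s)\<^sup>2 + (norm t)\<^sup>2 = 2 * (norm a)\<^sup>2 + 2 * (norm d)\<^sup>2"
    unfolding cmod_power2 st by (simp add: power2_eq_square algebra_simps)
  moreover have "(norm s)\<^sup>2 \<le> (norm a)\<^sup>2" "(norm t)\<^sup>2 \<le> (norm a)\<^sup>2"
    using assms by (auto intro: power_mono)
  ultimately have "(norm d)\<^sup>2 \<le> 0" by linarith
  then show ?thesis by (simp add: d_def)
qed

lemma super_sign_simps [simp]:
  "super_sign 0 p = 1" "super_sign p 0 = 1" "super_sign 1 1 = - 1"
  by (simp_all add: super_sign_def)

lemma super_sign_cases: "super_sign p q = 1 \<or> super_sign p q = - 1"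
  by (simp add: super_sign_def)

lemma super_sign_commute: "super_sign p q = super_sign q p"
  by (simp add: super_sign_def mult.commute)

locale fd_simple_lie_superalgebra =
  complex_fd_space scale Basis + simple_lie_superalgebra scale gr bracket
  for scale :: "complex \<Rightarrow> 'a::ab_group_add \<Rightarrow> 'a" and Basis :: "'a set"
    and gr :: "bit \<Rightarrow> 'a set" and bracket :: "'a \<Rightarrow> 'a \<Rightarrow> 'a"
begin

lemmas bracket_left = linear_opD[OF linear_left]
lemmas bracket_right = linear_opD[OF linear_right]

lemma gr_zero: "0 \<in> gr i"
  using subspace_gr by (rule subspace_0)

lemma homogeneous_sum:
  obtains x y where "x \<in> gr 0" "y \<in> gr 1" "z = x + y"
  using gr_sum by blast

lemma gr_add_eq_0:
  assumes "x \<in> gr i" "y \<in> gr (i + 1)" "x + y = 0"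
  shows "x = 0" "y = 0"
proof -
  have x: "x = - y" using assms(3) by (simp add: eq_neg_iff_add_eq_0)
  then have "x \<in> gr (i + 1)" using subspace_neg[OF subspace_gr assms(2)] by simp
  then have "x \<in> gr 0 \<inter> gr 1" using assms(1) by (cases i) auto
  then show "x = 0" using gr_Int by blast
  then show "y = 0" using x by simp
qed

lemma gr_add_unique:
  assumes "x \<in> gr 0" "y \<in> gr 1" "x' \<in> gr 0" "y' \<in> gr 1" "x + y = x' + y'"
  shows "x = x'" "y = y'"
proof -
  have "x - x' \<in> gr 0" "y - y' \<in> gr (0 + 1)" "(x - x') + (y - y') = 0"
    using assms subspace_diff[OF subspace_gr] by (auto simp: algebra_simps)
  from gr_add_eq_0[OF this] show "x = x'" "y = y'" by auto
qed

lemma UNIV_nonzero: "\<exists>x::'a. x \<noteq> 0"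
  using not_abelian by blast

text \<open>
  The number \<open>d\<close> is called the multiplier. The case \<open>d = 1\<close> gives the usual superderivations of
  parity \<open>p\<close>, and the multiplications of a transposed Poisson structure have \<open>d = 1/2\<close>.
\<close>

definition superderivation :: "complex \<Rightarrow> bit \<Rightarrow> ('a \<Rightarrow> 'a) \<Rightarrow> bool" where
  "superderivation d p f \<longleftrightarrow> linear_op f \<and> (\<forall>i. \<forall>x\<in>gr i. f x \<in> gr (i + p)) \<and>
     (\<forall>i. \<forall>x\<in>gr i. \<forall>y. f (bracket x y) =
        scale d (bracket (f x) y + scale (super_sign p i) (bracket x (f y))))"

lemma superderivation_linear: "superderivation d p f \<Longrightarrow> linear_op f"
  and superderivation_gr: "superderivation d p f \<Longrightarrow> x \<in> gr i \<Longrightarrow> f x \<in> gr (i + p)"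
  and superderivation_bracket: "superderivation d p f \<Longrightarrow> x \<in> gr i \<Longrightarrow>
    f (bracket x y) = scale d (bracket (f x) y + scale (super_sign p i) (bracket x (f y)))"
  by (auto simp: superderivation_def)

lemma superderivation_even_gr: "superderivation d 0 f \<Longrightarrow> x \<in> gr i \<Longrightarrow> f x \<in> gr i"
  using superderivation_gr[of d 0 f x i] by (metis add.right_neutral)

lemmas superderivation_linearD = linear_opD[OF superderivation_linear]

text \<open>
  By linearity it suffices to check the rule for homogeneous \<open>y\<close>.
\<close>

lemma superderivationI:
  assumes "linear_op f" "\<And>i x. x \<in> gr i \<Longrightarrow> f x \<in> gr (i + p)"
    and rule: "\<And>i j x y. x \<in> gr i \<Longrightarrow> y \<in> gr j \<Longrightarrow>
      f (bracket x y) = scale d (bracket (f x) y + scale (super_sign p i) (bracket x (f y)))"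
  shows "superderivation d p f"
proof -
  have "f (bracket x y) = scale d (bracket (f x) y + scale (super_sign p i) (bracket x (f y)))"
    if x: "x \<in> gr i" for i x y
  proof -
    obtain y0 y1 where "y0 \<in> gr 0" "y1 \<in> gr 1" "y = y0 + y1" by (rule homogeneous_sum)
    then show ?thesis
      using rule[OF x, of y0 0] rule[OF x, of y1 1]
      by (simp add: bracket_right linear_opD[OF assms(1)] algebra_simps)
  qed
  then show ?thesis using assms(1,2) unfolding superderivation_def by blast
qed

lemma superderivation_even_bracket:
  assumes "superderivation d 0 f"
  shows "f (bracket x y) = scale d (bracket (f x) y + bracket x (f y))"
proof -
  obtain x0 x1 where "x0 \<in> gr 0" "x1 \<in> gr 1" "x = x0 + x1" by (rule homogeneous_sum)
  then show ?thesis
    using superderivation_bracket[OF assms, of x0 0 y] superderivation_bracket[OF assms, of x1 1 y]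
    by (simp add: bracket_left superderivation_linearD[OF assms] algebra_simps)
qed

lemma superderivation_ad: "x \<in> gr p \<Longrightarrow> superderivation 1 p (bracket x)"
proof (rule superderivationI)
  assume x: "x \<in> gr p"
  show "linear_op (bracket x)" by (rule linear_right)
  show "bracket x y \<in> gr (i + p)" if "y \<in> gr i" for i y
    using mult_gr[OF x that] by (simp only: add.commute)
  show "bracket x (bracket y z)
      = scale 1 (bracket (bracket x y) z + scale (super_sign p i) (bracket y (bracket x z)))"
    if "y \<in> gr i" "z \<in> gr j" for i j y z
    using super_jacobi[OF x that] by simp
qed

definition supercommutator :: "bit \<Rightarrow> bit \<Rightarrow> ('a \<Rightarrow> 'a) \<Rightarrow> ('a \<Rightarrow> 'a) \<Rightarrow> 'a \<Rightarrow> 'a" where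
  "supercommutator p q f g x = f (g x) - scale (super_sign p q) (g (f x))"

text \<open>
  In \<open>f g [x, y]\<close> and \<open>g f [x, y]\<close> the mixed terms \<open>[g x, f y]\<close> and \<open>[f x, g y]\<close> occur with
  coefficients that differ exactly by the sign of the supercommutator, so they cancel.
\<close>

lemma superderivation_supercommutator:
  assumes f: "superderivation d p f" and g: "superderivation e q g"
  shows "superderivation (d * e) (p + q) (supercommutator p q f g)"
proof -
  note lin = superderivation_linearD[OF f] superderivation_linearD[OF g]
  show ?thesis
    unfolding superderivation_def
  proof (intro conjI allI ballI)
    show "linear_op (supercommutator p q f g)"
      by (rule linear_opI) (simp_all add: supercommutator_def lin algebra_simps)
  next
    fix i x assume x: "x \<in> gr i"
    have "f (g x) \<in> gr (i + (p + q))" "g (f x) \<in> gr (i + (p + q))"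
      using superderivation_gr[OF f superderivation_gr[OF g x]]
        superderivation_gr[OF g superderivation_gr[OF f x]]
      by (simp_all only: ac_simps)
    then show "supercommutator p q f g x \<in> gr (i + (p + q))"
      unfolding supercommutator_def
      by (intro subspace_diff[OF subspace_gr] subspace_scale[OF subspace_gr])
  next
    fix i x y assume x: "x \<in> gr i"
    let ?a = "super_sign p q" and ?b = "super_sign p i" and ?c = "super_sign q i"
    have signs: "super_sign p (i + q) = ?b * ?a" "super_sign q (i + p) = ?c * ?a"
      "super_sign (p + q) i = ?b * ?c"
      by (cases i; cases p; cases q; simp)+
    have fg: "f (g (bracket x y)) = scale (d * e) (bracket (f (g x)) y
        + scale (?b * ?a) (bracket (g x) (f y)) + scale ?c (bracket (f x) (g y))
        + scale (?b * ?c) (bracket x (f (g y))))"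
      unfolding superderivation_bracket[OF g x] lin
        superderivation_bracket[OF f superderivation_gr[OF g x]]
        superderivation_bracket[OF f x] signs
      by (simp add: algebra_simps)
    have gf: "g (f (bracket x y)) = scale (d * e) (bracket (g (f x)) y
        + scale (?c * ?a) (bracket (f x) (g y)) + scale ?b (bracket (g x) (f y))
        + scale (?b * ?c) (bracket x (g (f y))))"
      unfolding superderivation_bracket[OF f x] lin
        superderivation_bracket[OF g superderivation_gr[OF f x]]
        superderivation_bracket[OF g x] signs
      by (simp add: algebra_simps)
    show "supercommutator p q f g (bracket x y) = scale (d * e)
        (bracket (supercommutator p q f g x) y
         + scale (super_sign (p + q) i) (bracket x (supercommutator p q f g y)))"
      unfolding supercommutator_def fg gf signs bracket_left bracket_right
      using super_sign_cases[of p q] by (auto simp: algebra_simps)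
  qed
qed

section \<open>Eigenvalues of even superderivations\<close>

text \<open>
  The identity behind this is
  \<open>(f - d (s + t)) [x, y] = d ([(f - s) x, y] + [x, (f - t) y])\<close>,
  where each summand on the right has a shorter annihilating list on one side.
\<close>

lemma root_space_bracket:
  assumes f: "superderivation d 0 f"
    and U: "\<And>s t. s \<in> S \<Longrightarrow> t \<in> T \<Longrightarrow> d * (s + t) \<in> U"
    and "x \<in> root_space f S" "y \<in> root_space f T"
  shows "bracket x y \<in> root_space f U"
proof -
  obtain ss ts where "set ss \<subseteq> S" "fold (shift f) ss x = 0" "set ts \<subseteq> T" "fold (shift f) ts y = 0"
    using assms(3,4) unfolding root_space_def by blast
  then show ?thesis
  proof (induction ss arbitrary: x y ts)
    case Nil
    then show ?case by (simp add: bracket_left zero_in_root_space)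
  next
    case (Cons s ss)
    note outer_IH = Cons.IH and outer_prems = Cons.prems
    from Cons.prems(3,4) show ?case
    proof (induction ts arbitrary: y)
      case Nil
      then show ?case by (simp add: bracket_right zero_in_root_space)
    next
      case (Cons t ts)
      have "bracket (shift f s x) y \<in> root_space f U"
        using outer_IH[of "shift f s x" "t # ts" y] outer_prems Cons.prems by simp
      moreover have "bracket x (shift f t y) \<in> root_space f U"
        using Cons by simp
      moreover have "shift f (d * (s + t)) (bracket x y)
          = scale d (bracket (shift f s x) y + bracket x (shift f t y))"
        by (simp add: shift_def superderivation_even_bracket[OF f] bracket_left bracket_right
            algebra_simps)
      ultimately have "shift f (d * (s + t)) (bracket x y) \<in> root_space f U"
        using subspace_root_space[OF superderivation_linear[OF f], of U]
        by (simp add: subspace_add subspace_scale)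
      moreover have "d * (s + t) \<in> U" using U outer_prems(1) Cons.prems(1) by simp
      ultimately show ?case by (rule root_space_shift)
    qed
  qed
qed

lemma graded_ideal_root_space:
  assumes f: "superderivation d 0 f" and T: "root_space f T = UNIV"
    and S: "\<And>s t. s \<in> S \<Longrightarrow> t \<in> T \<Longrightarrow> d * (s + t) \<in> S"
  shows "graded_ideal (root_space f S)"
  unfolding graded_ideal_def
proof (intro conjI allI ballI impI)
  note lin = superderivation_linear[OF f]
  show "subspace (root_space f S)" by (rule subspace_root_space[OF lin])
  fix x y
  {
    assume xy: "x \<in> gr 0" "y \<in> gr 1" "x + y \<in> root_space f S"
    then obtain cs where cs: "set cs \<subseteq> S" "fold (shift f) cs (x + y) = 0"
      unfolding root_space_def by blast
    have gr: "fold (shift f) cs z \<in> gr i" if "z \<in> gr i" for z i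
      using that
    proof (induction cs arbitrary: z)
      case (Cons c cs)
      have "shift f c z \<in> gr i"
        unfolding shift_def using superderivation_even_gr[OF f Cons.prems] Cons.prems
        by (intro subspace_diff[OF subspace_gr] subspace_scale[OF subspace_gr]) simp_all
      then show ?case using Cons.IH by simp
    qed simp
    have "fold (shift f) cs x + fold (shift f) cs y = 0"
      using cs(2) linear_opD(1)[OF linear_op_fold_shift[OF lin]] by simp
    then have "fold (shift f) cs x = 0" "fold (shift f) cs y = 0"
      using gr_add_unique[OF gr[OF xy(1)] gr[OF xy(2)] gr_zero gr_zero] by simp_all
    then show "x \<in> root_space f S" "y \<in> root_space f S"
      unfolding root_space_def using cs(1) by blast+
  }
  assume y: "y \<in> root_space f S"
  have x: "x \<in> root_space f T" using T by simp
  show "bracket x y \<in> root_space f S"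
    using S by (intro root_space_bracket[OF f _ x y]) (metis add.commute)
  show "bracket y x \<in> root_space f S"
    using S by (intro root_space_bracket[OF f _ y x])
qed

lemma shift_funpow_root_space:
  "(shift f c ^^ n) x = 0 \<Longrightarrow> x \<in> root_space f {c}"
  unfolding root_space_def by (intro CollectI exI[of _ "replicate n c"]) (auto simp: fold_replicate)

text \<open>
  Let \<open>a\<close> be an eigenvalue of largest modulus, \<open>T\<close> the closed disc around 0 through \<open>a\<close>, and
  \<open>S = T - {a}\<close>. Since \<open>a\<close> is an extreme point of \<open>T\<close>, the root space of \<open>S\<close> is an ideal; it omits
  the eigenvectors for \<open>a\<close>, so it is zero. If \<open>k \<ge> 2\<close> and \<open>a \<noteq> 0\<close>, all brackets would lie in the
  root space of \<open>2 a / 2^k \<in> S\<close>, and the algebra would be abelian.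
\<close>

lemma even_superderivation_single_root:
  assumes f: "superderivation (1 / 2 ^ k) 0 f" and k: "k \<ge> 1"
  shows "\<exists>a. nilpotent_op (shift f a) \<and> (k \<ge> 2 \<longrightarrow> a = 0)"
proof -
  note lin = superderivation_linear[OF f]
  obtain cs where cs: "\<And>x. fold (shift f) cs x = 0"
    and ev: "\<And>c. c \<in> set cs \<Longrightarrow> \<exists>v. v \<noteq> 0 \<and> f v = scale c v"
    using annihilating_list_of_eigenvalues[OF lin] by metis
  have "cs \<noteq> []" using cs UNIV_nonzero by auto
  have "Max (norm ` set cs) \<in> norm ` set cs" using \<open>cs \<noteq> []\<close> by (intro Max_in) auto
  then obtain a where a: "a \<in> set cs" "\<And>c. c \<in> set cs \<Longrightarrow> norm c \<le> norm a"
    by (metis List.finite_set Max_ge finite_imageI imageE imageI)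
  define T where "T = {c::complex. norm c \<le> norm a}"
  define S where "S = T - {a}"
  have T: "root_space f T = UNIV"
    using cs a(2) unfolding root_space_def T_def by blast
  have S: "1 / 2 ^ k * (s + t) \<in> S" if "s \<in> S" "t \<in> T" for s t
  proof -
    have st: "norm s \<le> norm a" "norm t \<le> norm a" "s \<noteq> a" using that by (auto simp: S_def T_def)
    then have n: "norm (s + t) \<le> 2 * norm a" using norm_triangle_ineq[of s t] by linarith
    have k2: "(2::real) \<le> 2 ^ k" using k power_increasing[of 1 k "2::real"] by simp
    have "norm (1 / 2 ^ k * (s + t)) = norm (s + t) / 2 ^ k"
      by (simp add: norm_mult norm_divide norm_power)
    also have "\<dots> \<le> norm a"
    proof -
      have "norm (s + t) \<le> norm a * 2 ^ k"
        using n mult_left_mono[OF k2, of "norm a"] by simp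
      then show ?thesis by (simp add: divide_le_eq)
    qed
    finally have le: "norm (1 / 2 ^ k * (s + t)) \<le> norm a" .
    have "1 / 2 ^ k * (s + t) \<noteq> a"
    proof
      assume "1 / 2 ^ k * (s + t) = a"
      then have sum: "s + t = 2 ^ k * a" by (auto simp: field_simps)
      show False
      proof (cases "k = 1")
        case True
        then show False using complex_midpoint_extreme[of s a t] st sum by simp
      next
        case False
        then have "(4::real) \<le> 2 ^ k" using k power_increasing[of 2 k "2::real"] by simp
        then have "4 * norm a \<le> 2 ^ k * norm a" by (intro mult_right_mono) auto
        moreover have "norm (s + t) = 2 ^ k * norm a" by (simp add: sum norm_mult norm_power)
        ultimately have "norm a = 0" using n norm_ge_zero[of a] by linarith
        then show False using st by simp
      qed
    qed
    then show ?thesis using le by (simp add: S_def T_def)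
  qed
  have "root_space f S \<noteq> UNIV"
    using ev[OF a(1)] eigenvalue_in_root_set[OF lin, of _ a S] by (auto simp: S_def)
  then have S0: "root_space f S = {0}"
    using graded_ideal_trivial[OF graded_ideal_root_space[OF f T S]] by blast
  \<comment> \<open>Applying the factors \<open>f - a\<close> of the annihilating product first leads into the root space of
    \<open>S\<close>, so these factors alone already annihilate everything.\<close>
  define n where "n = length (filter (\<lambda>c. c = a) cs)"
  have rep: "filter (\<lambda>c. c = a) cs = replicate n a"
    unfolding n_def by (rule replicate_length_same[symmetric]) simp
  have nil: "(shift f a ^^ n) x = 0" for x
  proof -
    have "fold (shift f) (filter (\<lambda>c. c \<noteq> a) cs) ((shift f a ^^ n) x) = 0"
      using cs[of x] fold_shift_partition[OF lin, of cs x "\<lambda>c. c = a"]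
      by (simp add: rep fold_replicate)
    then have "(shift f a ^^ n) x \<in> root_space f S"
      unfolding root_space_def S_def T_def using a(2)
      by (intro CollectI exI[of _ "filter (\<lambda>c. c \<noteq> a) cs"]) auto
    then show ?thesis using S0 by simp
  qed
  moreover have "a = 0" if k: "k \<ge> 2"
  proof (rule ccontr)
    assume "a \<noteq> 0"
    have k4: "(4::real) \<le> 2 ^ k" using k power_increasing[of 2 k "2::real"] by simp
    let ?b = "1 / 2 ^ k * (a + a)"
    have b: "norm ?b = 2 * norm a / 2 ^ k"
      by (simp add: norm_mult norm_divide norm_power flip: mult_2)
    have "norm ?b < norm a"
    proof -
      have "2 * norm a < 2 ^ k * norm a"
        using k4 \<open>a \<noteq> 0\<close> by (intro mult_strict_right_mono) auto
      then show ?thesis unfolding b by (simp add: divide_less_eq mult.commute)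
    qed
    then have bS: "?b \<in> S" by (auto simp: S_def T_def)
    have "bracket x y = 0" for x y
    proof -
      have "bracket x y \<in> root_space f S"
        using bS shift_funpow_root_space[OF nil] by (intro root_space_bracket[OF f, of "{a}" "{a}"]) auto
      then show ?thesis using S0 by simp
    qed
    then show False using not_abelian by blast
  qed
  ultimately show ?thesis unfolding nilpotent_op_def by blast
qed

section \<open>Superderivations of small multiplier vanish\<close>

definition homogeneous_brackets :: "'a set" where
  "homogeneous_brackets = {bracket x y |i j x y. x \<in> gr i \<and> y \<in> gr j}"

lemma bracket_in_span: "bracket x y \<in> span homogeneous_brackets"
proof -
  obtain x0 x1 where x: "x0 \<in> gr 0" "x1 \<in> gr 1" "x = x0 + x1" by (rule homogeneous_sum)
  obtain y0 y1 where y: "y0 \<in> gr 0" "y1 \<in> gr 1" "y = y0 + y1" by (rule homogeneous_sum)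
  have "bracket u v \<in> span homogeneous_brackets" if "u \<in> gr i" "v \<in> gr j" for u v i j
    using that unfolding homogeneous_brackets_def by (intro span_base) blast
  then have "bracket x0 y0 + bracket x0 y1 + (bracket x1 y0 + bracket x1 y1) \<in> span homogeneous_brackets"
    using x y by (intro span_add) blast+
  then show ?thesis by (simp add: x y bracket_left bracket_right ac_simps)
qed

text \<open>
  The derived algebra is a non-zero graded ideal; it is graded because it is spanned by homogeneous
  elements.
\<close>

lemma span_homogeneous_brackets: "span homogeneous_brackets = UNIV"
proof -
  let ?I = "span homogeneous_brackets"
  have comp: "\<exists>x\<in>gr 0 \<inter> ?I. \<exists>y\<in>gr 1 \<inter> ?I. z = x + y" if "z \<in> ?I" for z
    using that
  proof (induction rule: span_induct_alt)
    case base
    show ?case using gr_zero span_zero by (intro bexI[of _ 0]) auto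
  next
    case (step c b z)
    obtain x y where xy: "x \<in> gr 0 \<inter> ?I" "y \<in> gr 1 \<inter> ?I" "z = x + y" using step by blast
    obtain i where b: "b \<in> gr i" using step(1) mult_gr unfolding homogeneous_brackets_def by blast
    then have cb: "scale c b \<in> gr i \<inter> ?I"
      using step(1) subspace_scale[OF subspace_gr] by (auto intro: span_scale span_base)
    note add = subspace_add[OF subspace_gr] span_add
    show ?case
    proof (cases "i = 0")
      case True
      then show ?thesis using xy cb add
        by (intro bexI[of _ "scale c b + x"] bexI[of _ y]) (auto simp: ac_simps)
    next
      case False
      then show ?thesis using xy cb add
        by (intro bexI[of _ x] bexI[of _ "scale c b + y"]) (auto simp: ac_simps)
    qed
  qed
  have "graded_ideal ?I"
    unfolding graded_ideal_def
  proof (intro conjI allI ballI impI)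
    show "subspace ?I" by (rule subspace_span)
    show "bracket x y \<in> ?I" "bracket y x \<in> ?I" for x y by (rule bracket_in_span)+
    show "x \<in> ?I" "y \<in> ?I" if "x \<in> gr 0" "y \<in> gr 1" "x + y \<in> ?I" for x y
      using comp[OF that(3)] gr_add_unique[OF that(1,2)] by blast+
  qed
  moreover have "?I \<noteq> {0}" using not_abelian bracket_in_span by blast
  ultimately show ?thesis using graded_ideal_trivial by blast
qed

text \<open>
  The sum norm in the coordinates of the basis. The quantity \<open>op_bound\<close> below dominates the
  operator norm that belongs to it.
\<close>

definition coord_norm :: "'a \<Rightarrow> real" where
  "coord_norm v = (\<Sum>b\<in>Basis. norm (representation Basis v b))"

definition op_bound :: "('a \<Rightarrow> 'a) \<Rightarrow> real" where
  "op_bound f = (\<Sum>b\<in>Basis. coord_norm (f b))"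

lemma in_span_Basis: "v \<in> span Basis"
  by (simp add: span_Basis)

lemma coord_norm_nonneg: "coord_norm v \<ge> 0"
  unfolding coord_norm_def by (intro sum_nonneg) auto

lemma op_bound_nonneg: "op_bound f \<ge> 0"
  unfolding op_bound_def by (intro sum_nonneg) (auto intro: coord_norm_nonneg)

lemma coord_norm_add: "coord_norm (v + w) \<le> coord_norm v + coord_norm w"
  unfolding coord_norm_def
  by (simp add: representation_add[OF independent_Basis in_span_Basis in_span_Basis]
      norm_triangle_ineq sum_mono flip: sum.distrib)

lemma coord_norm_scale: "coord_norm (scale c v) = norm c * coord_norm v"
  unfolding coord_norm_def
  by (simp add: representation_scale[OF independent_Basis in_span_Basis] norm_mult sum_distrib_left)

lemma coord_norm_sum: "coord_norm (sum g A) \<le> (\<Sum>a\<in>A. coord_norm (g a))"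
proof (induction A rule: infinite_finite_induct)
  case (insert x A)
  then show ?case using coord_norm_add[of "g x" "sum g A"] by simp
qed (simp_all add: coord_norm_def representation_zero)

lemma Basis_expansion: "(\<Sum>b\<in>Basis. scale (representation Basis v b) b) = v"
  by (rule sum_representation_eq[OF independent_Basis in_span_Basis finite_Basis]) simp

lemma coord_norm_eq_0: "coord_norm v = 0 \<Longrightarrow> v = 0"
  using Basis_expansion[of v] unfolding coord_norm_def
  by (subst (asm) sum_nonneg_eq_0_iff[OF finite_Basis]) auto

lemma coord_norm_linear_op:
  assumes "linear_op f"
  shows "coord_norm (f v) \<le> coord_norm v * op_bound f"
proof -
  interpret f: Vector_Spaces.linear scale scale f by (fact assms)
  have "f v = f (\<Sum>b\<in>Basis. scale (representation Basis v b) b)" by (simp add: Basis_expansion)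
  also have "\<dots> = (\<Sum>b\<in>Basis. scale (representation Basis v b) (f b))"
    by (simp add: f.sum f.scale)
  also have "coord_norm \<dots> \<le> (\<Sum>b\<in>Basis. norm (representation Basis v b) * coord_norm (f b))"
    by (rule order_trans[OF coord_norm_sum]) (simp add: coord_norm_scale)
  also have "\<dots> \<le> (\<Sum>b\<in>Basis. norm (representation Basis v b) * op_bound f)"
    unfolding op_bound_def
    by (intro sum_mono mult_left_mono member_le_sum finite_Basis coord_norm_nonneg norm_ge_zero)
  finally show ?thesis by (simp add: coord_norm_def sum_distrib_right)
qed

text \<open>
  The constant must not depend on \<open>f\<close>. The elements \<open>z\<close> that have such a constant form a subspace,
  and it contains the brackets \<open>[u, v]\<close> with homogeneous \<open>u\<close> because
  \<open>f [u, v] = d ([f u, v] \<plusminus> [u, f v])\<close>.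
\<close>

lemma superderivation_pointwise_bound:
  "\<exists>C\<ge>0. \<forall>d p f. superderivation d p f \<longrightarrow> coord_norm (f z) \<le> norm d * (C * op_bound f)"
proof -
  have "z \<in> span homogeneous_brackets" by (simp add: span_homogeneous_brackets)
  then show ?thesis
  proof (induction rule: span_induct_alt)
    case base
    show ?case
      by (intro exI[of _ 0]) (auto simp: superderivation_linearD coord_norm_def representation_zero)
  next
    case (step c b z)
    obtain C where C: "C \<ge> 0"
      "\<And>d p f. superderivation d p f \<Longrightarrow> coord_norm (f z) \<le> norm d * (C * op_bound f)"
      using step by blast
    obtain i u v where u: "u \<in> gr i" and b: "b = bracket u v"
      using step(1) unfolding homogeneous_brackets_def by blast
    define L where "L = op_bound (\<lambda>w. bracket w v)"
    define R where "R = op_bound (bracket u)"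
    define D where "D = coord_norm u * L + coord_norm v * R"
    have D: "D \<ge> 0"
      unfolding D_def L_def R_def
      by (intro add_nonneg_nonneg mult_nonneg_nonneg coord_norm_nonneg op_bound_nonneg)
    have bound: "coord_norm (f b) \<le> norm d * (D * op_bound f)" if f: "superderivation d p f" for d p f
    proof -
      have sgn: "norm (super_sign p i) = 1" using super_sign_cases[of p i] by auto
      have "coord_norm (bracket (f u) v) \<le> coord_norm (f u) * L"
        unfolding L_def by (rule coord_norm_linear_op[OF linear_left])
      also have "\<dots> \<le> coord_norm u * op_bound f * L"
        unfolding L_def
        by (intro mult_right_mono coord_norm_linear_op superderivation_linear[OF f] op_bound_nonneg)
      finally have 1: "coord_norm (bracket (f u) v) \<le> coord_norm u * op_bound f * L" .
      have "coord_norm (bracket u (f v)) \<le> coord_norm (f v) * R"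
        unfolding R_def by (rule coord_norm_linear_op[OF linear_right])
      also have "\<dots> \<le> coord_norm v * op_bound f * R"
        unfolding R_def
        by (intro mult_right_mono coord_norm_linear_op superderivation_linear[OF f] op_bound_nonneg)
      finally have 2: "coord_norm (bracket u (f v)) \<le> coord_norm v * op_bound f * R" .
      have "coord_norm (bracket (f u) v + scale (super_sign p i) (bracket u (f v)))
          \<le> coord_norm (bracket (f u) v) + coord_norm (bracket u (f v))"
        using coord_norm_add[of "bracket (f u) v" "scale (super_sign p i) (bracket u (f v))"]
        by (simp add: coord_norm_scale sgn)
      also have "\<dots> \<le> D * op_bound f" using 1 2 by (simp add: D_def algebra_simps)
      finally show ?thesis
        unfolding b superderivation_bracket[OF f u] coord_norm_scale
        by (intro mult_left_mono) auto
    qed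
    show ?case
    proof (intro exI[of _ "norm c * D + C"] conjI allI impI)
      show "norm c * D + C \<ge> 0" using C D by simp
      fix d p f assume f: "superderivation d p f"
      have "coord_norm (f (scale c b + z)) \<le> norm c * coord_norm (f b) + coord_norm (f z)"
        using coord_norm_add[of "scale c (f b)" "f z"]
        by (simp add: superderivation_linearD[OF f] coord_norm_scale)
      also have "\<dots> \<le> norm c * (norm d * (D * op_bound f)) + norm d * (C * op_bound f)"
        using bound[OF f] C(2)[OF f] by (intro add_mono mult_left_mono) auto
      finally show "coord_norm (f (scale c b + z)) \<le> norm d * ((norm c * D + C) * op_bound f)"
        by (simp add: algebra_simps)
    qed
  qed
qed

text \<open>
  Summing the pointwise bounds over the basis gives \<open>op_bound f \<le> |d| K op_bound f\<close>.
\<close>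

lemma superderivation_small_multiplier:
  "\<exists>e>0. \<forall>d p f. superderivation d p f \<longrightarrow> norm d < e \<longrightarrow> (\<forall>x. f x = 0)"
proof -
  obtain C where C: "\<And>z. C z \<ge> 0"
    "\<And>z d p f. superderivation d p f \<Longrightarrow> coord_norm (f z) \<le> norm d * (C z * op_bound f)"
    using superderivation_pointwise_bound by metis
  \<comment> \<open>The summand 1 only serves to make \<open>K\<close> positive.\<close>
  define K where "K = (\<Sum>b\<in>Basis. C b) + 1"
  have K: "K > 0" unfolding K_def using sum_nonneg[of Basis C] C(1) by (simp add: add_nonneg_pos)
  have "f x = 0" if f: "superderivation d p f" and d: "norm d < 1 / K" for d p f x
  proof -
    have "op_bound f \<le> (\<Sum>b\<in>Basis. norm d * (C b * op_bound f))"
      unfolding op_bound_def[of f] by (intro sum_mono C(2)[OF f, unfolded op_bound_def])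
    also have "\<dots> = norm d * (K - 1) * op_bound f"
      by (simp add: K_def sum_distrib_left sum_distrib_right mult.assoc)
    also have "\<dots> \<le> norm d * K * op_bound f"
      by (intro mult_right_mono mult_left_mono op_bound_nonneg) auto
    finally have le: "op_bound f \<le> norm d * K * op_bound f" .
    have "norm d * K < 1" using d K by (simp add: pos_less_divide_eq)
    have "op_bound f = 0"
    proof (rule ccontr)
      assume "op_bound f \<noteq> 0"
      then have "op_bound f > 0" using op_bound_nonneg[of f] by simp
      then show False using le mult_strict_right_mono[OF \<open>norm d * K < 1\<close>, of "op_bound f"] by simp
    qed
    then have "coord_norm (f x) \<le> 0"
      using coord_norm_linear_op[OF superderivation_linear[OF f], of x] by simp
    then show ?thesis using coord_norm_nonneg[of "f x"] coord_norm_eq_0 by (metis order_antisym)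
  qed
  then show ?thesis using K by (intro exI[of _ "1 / K"]) auto
qed

section \<open>Multipliers that are powers of one half\<close>

text \<open>
  For a graded subspace, super skew symmetry turns left ideals into right ideals.
\<close>

lemma graded_idealI:
  assumes I: "subspace I"
    and graded: "\<And>x y. x \<in> gr 0 \<Longrightarrow> y \<in> gr 1 \<Longrightarrow> x + y \<in> I \<Longrightarrow> x \<in> I \<and> y \<in> I"
    and left: "\<And>i x y. x \<in> gr i \<Longrightarrow> y \<in> I \<Longrightarrow> bracket x y \<in> I"
  shows "graded_ideal I"
proof -
  have right: "bracket y x \<in> I" if y: "y \<in> I" and x: "x \<in> gr i" for x y i
  proof -
    obtain y0 y1 where y01: "y0 \<in> gr 0" "y1 \<in> gr 1" "y = y0 + y1" by (rule homogeneous_sum)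
    have "bracket y' x \<in> I" if "y' \<in> I" "y' \<in> gr j" for y' j
      unfolding super_skew_symmetric[OF that(2) x]
      by (intro subspace_neg[OF I] subspace_scale[OF I] left[OF x] that(1))
    then show ?thesis
      using graded[OF y01(1,2)] y y01 subspace_add[OF I] by (auto simp: bracket_left)
  qed
  have "bracket x y \<in> I \<and> bracket y x \<in> I" if y: "y \<in> I" for x y
  proof -
    obtain x0 x1 where x: "x0 \<in> gr 0" "x1 \<in> gr 1" "x = x0 + x1" by (rule homogeneous_sum)
    then show ?thesis
      using left[OF _ y] right[OF y] subspace_add[OF I] by (auto simp: bracket_left bracket_right)
  qed
  then show ?thesis unfolding graded_ideal_def using I graded by blast
qed

text \<open>
  The common kernel \<open>V\<close> of the family is not zero. It is an ideal, since for \<open>v \<in> V\<close> the vector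
  \<open>f [x, v]\<close> is, up to sign, the value at \<open>v\<close> of the supercommutator of \<open>ad x\<close> and \<open>f\<close>, which lies
  in the family again. By simplicity \<open>V\<close> is the whole algebra.
\<close>

lemma stable_supercommuting_family_zero:
  assumes sd: "\<And>p f. f \<in> N p \<Longrightarrow> superderivation d p f"
    and nil: "\<And>p f. f \<in> N p \<Longrightarrow> nilpotent_op f"
    and com: "\<And>p q f g x. f \<in> N p \<Longrightarrow> g \<in> N q \<Longrightarrow> supercommutator p q f g x = 0"
    and stab: "\<And>i p f x. x \<in> gr i \<Longrightarrow> f \<in> N p \<Longrightarrow> supercommutator i p (bracket x) f \<in> N (i + p)"
    and f: "f \<in> N p"
  shows "f x = 0"
proof -
  define W where "W = (\<Union>p. N p)"
  define V where "V = {v. \<forall>f\<in>W. f v = 0}"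
  have lin: "linear_op f" if "f \<in> W" for f
    using that sd superderivation_linear unfolding W_def by blast
  have "\<exists>v. v \<noteq> 0 \<and> (\<forall>f\<in>W. f v = 0)"
  proof (rule common_kernel[OF lin])
    show "\<exists>c. \<forall>x. f (g x) = scale c (g (f x))" if fg: "f \<in> W" "g \<in> W" for f g
    proof -
      obtain p q where "f \<in> N p" "g \<in> N q" using fg unfolding W_def by blast
      then have "f (g x) = scale (super_sign p q) (g (f x))" for x
        using com[of f p g q x] by (simp add: supercommutator_def)
      then show ?thesis by blast
    qed
  qed (use nil UNIV_nonzero in \<open>auto simp: W_def\<close>)
  then have nz: "V \<noteq> {0}" unfolding V_def by blast
  have "graded_ideal V"
  proof (rule graded_idealI)
    show "subspace V"
      unfolding V_def subspace_def by (auto simp: linear_opD[OF lin])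
  next
    fix x y assume x: "x \<in> gr 0" and y: "y \<in> gr 1" and xy: "x + y \<in> V"
    have "f x = 0 \<and> f y = 0" if f: "f \<in> N p" for f p
    proof -
      have "f (x + y) = 0" using xy f unfolding V_def W_def by blast
      then have "f x + f y = 0" by (simp add: superderivation_linearD[OF sd[OF f]])
      moreover have "f x \<in> gr p" "f y \<in> gr (p + 1)"
        using superderivation_gr[OF sd[OF f] x] superderivation_gr[OF sd[OF f] y]
        by (simp_all only: add.commute add_0)
      ultimately show ?thesis using gr_add_eq_0 by blast
    qed
    then show "x \<in> V \<and> y \<in> V" unfolding V_def W_def by blast
  next
    fix i x v assume x: "x \<in> gr i" and v: "v \<in> V"
    have "f (bracket x v) = 0" if f: "f \<in> N p" for f p
    proof -
      have "supercommutator i p (bracket x) f v = 0" "f v = 0"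
        using v stab[OF x f] f unfolding V_def W_def by blast+
      then show ?thesis
        using super_sign_cases[of i p] by (auto simp: supercommutator_def bracket_right)
    qed
    then show "bracket x v \<in> V" unfolding V_def W_def by blast
  qed
  then have "V = UNIV" using graded_ideal_trivial nz by blast
  then show ?thesis using f unfolding V_def W_def by blast
qed

text \<open>
  The supercommutator of an odd operator with itself is twice its square.
\<close>

lemma odd_square_zero:
  assumes "supercommutator 1 1 f f x = 0"
  shows "f (f x) = 0"
proof -
  have "scale 2 (f (f x)) = 0"
    using assms scale_left_distrib[of 1 1 "f (f x)"] by (simp add: supercommutator_def)
  then show ?thesis by simp
qed

lemma nilpotent_op_square_zero: "(\<And>x. f (f x) = 0) \<Longrightarrow> nilpotent_op f"
  unfolding nilpotent_op_def by (intro exI[of _ 2]) (simp add: numeral_2_eq_2)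

lemma shift_0: "shift f 0 = f"
  by (simp add: shift_def fun_eq_iff)

text \<open>
  Descending induction on \<open>k\<close>, started at the multipliers that are small enough for
  \<open>superderivation_small_multiplier\<close>. In the step, supercommutators have multiplier \<open>1/2^(2 k)\<close> and
  vanish. So the superderivations with multiplier \<open>1/2^k\<close> supercommute; the odd ones have square
  zero, and the even ones are nilpotent since their only eigenvalue is 0.
\<close>

lemma superderivation_half_power_zero:
  assumes "superderivation (1 / 2 ^ k) p f" "k \<ge> 2"
  shows "f x = 0"
proof -
  obtain e where e: "e > 0"
    "\<And>d p f x. superderivation d p f \<Longrightarrow> norm d < e \<Longrightarrow> f x = 0"
    using superderivation_small_multiplier by blast
  obtain m where m: "(1 / 2) ^ m < e" using real_arch_pow_inv[OF e(1), of "1 / 2"] by auto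
  show ?thesis
    using assms
  proof (induction "m - k" arbitrary: k p f x rule: less_induct)
    case less
    show ?case
    proof (cases "k \<ge> m")
      case True
      have "norm (1 / 2 ^ k :: complex) = (1 / 2) ^ k"
        by (simp add: norm_divide norm_power power_one_over)
      also have "\<dots> \<le> (1 / 2) ^ m" using True by (intro power_decreasing) auto
      finally show ?thesis using e(2)[OF less.prems(1)] m by simp
    next
      case False
      define N where "N = (\<lambda>p. {f. superderivation (1 / 2 ^ k) p f})"
      have com: "supercommutator p q f g x = 0" if "f \<in> N p" "g \<in> N q" for p q f g x
      proof (rule less.hyps[of "k + k" "p + q" "supercommutator p q f g"])
        show "superderivation (1 / 2 ^ (k + k)) (p + q) (supercommutator p q f g)"
          using superderivation_supercommutator[of "1 / 2 ^ k" p f "1 / 2 ^ k" q g] that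
          by (simp add: N_def power_add)
      qed (use False less.prems(2) in auto)
      show ?thesis
      proof (rule stable_supercommuting_family_zero[where N = N and f = f and p = p])
        show "superderivation (1 / 2 ^ k) p f" if "f \<in> N p" for p f
          using that by (simp add: N_def)
        show "nilpotent_op f" if f: "f \<in> N p" for p f
        proof (cases "p = 0")
          case True
          then show ?thesis
            using even_superderivation_single_root[of k f] f less.prems(2) by (auto simp: N_def shift_0)
        next
          case False
          then show ?thesis
            using odd_square_zero com f by (intro nilpotent_op_square_zero) simp
        qed
        show "supercommutator i p (bracket x) f \<in> N (i + p)" if "x \<in> gr i" "f \<in> N p" for i p f x
          using superderivation_supercommutator[OF superderivation_ad[OF that(1)], of "1 / 2 ^ k" p f] that(2)
          by (simp add: N_def)
        show "f \<in> N p" using less.prems(1) by (simp add: N_def)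
      qed (rule com)
    qed
  qed
qed

section \<open>The multiplier one half\<close>

lemma half_superderivations_supercommute:
  assumes "superderivation (1 / 2) p f" "superderivation (1 / 2) q g"
  shows "supercommutator p q f g x = 0"
proof (rule superderivation_half_power_zero[of 2 "p + q" "supercommutator p q f g"])
  show "superderivation (1 / 2 ^ 2) (p + q) (supercommutator p q f g)"
    using superderivation_supercommutator[OF assms] by simp
qed simp

lemma half_superderivation_single_root:
  assumes "superderivation (1 / 2) 0 f"
  shows "\<exists>a. nilpotent_op (shift f a)"
  using even_superderivation_single_root[of 1 f] assms by auto

lemma nilpotent_shift_injective:
  assumes "linear_op f" "nilpotent_op (shift f a)" "a \<noteq> 0" "f v = 0"
  shows "v = 0"
proof (rule ccontr)
  assume "v \<noteq> 0"
  moreover have "v \<in> root_space f {a}"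
    using assms(2) shift_funpow_root_space unfolding nilpotent_op_def by blast
  ultimately have "0 \<in> {a}"
    using assms(4) by (intro eigenvalue_in_root_set[OF assms(1), of v]) auto
  then show False using assms(3) by simp
qed

text \<open>
  Put \<open>h = [ad x, f]\<close>. It commutes with \<open>f\<close>, so \<open>[ad x, f^(n+1)] = (n+1) f^n h\<close>. If \<open>f^(n+1)\<close> is
  the first power that vanishes, then \<open>f^n h = h f^n = 0\<close>, so an injective \<open>h\<close> would give \<open>f^n = 0\<close>.
\<close>

lemma even_commutator_not_injective:
  assumes x: "x \<in> gr 0" and f: "superderivation (1 / 2) 0 f" "nilpotent_op f"
  shows "\<exists>v. v \<noteq> 0 \<and> supercommutator 0 0 (bracket x) f v = 0"
proof (rule ccontr)
  define h where "h = supercommutator 0 0 (bracket x) f"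
  assume "\<not> ?thesis"
  then have inj: "h v = 0 \<Longrightarrow> v = 0" for v unfolding h_def by blast
  have h: "superderivation (1 / 2) 0 h"
    using superderivation_supercommutator[OF superderivation_ad[OF x] f(1)] by (simp add: h_def)
  note lin = superderivation_linearD[OF f(1)] superderivation_linearD[OF h]
  have fh: "f (h v) = h (f v)" for v
    using half_superderivations_supercommute[OF f(1) h, of v] by (simp add: supercommutator_def)
  have fnh: "(f ^^ n) (h v) = h ((f ^^ n) v)" for n v by (induction n) (simp_all add: fh)
  have xf: "bracket x (f v) = f (bracket x v) + h v" for v
    by (simp add: h_def supercommutator_def)
  have comm: "bracket x ((f ^^ Suc n) v) = (f ^^ Suc n) (bracket x v) + scale (of_nat (Suc n)) ((f ^^ n) (h v))"
    for n v
  proof (induction n)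
    case (Suc n)
    have "bracket x ((f ^^ Suc (Suc n)) v) = f (bracket x ((f ^^ Suc n) v)) + h ((f ^^ Suc n) v)"
      by (simp add: xf)
    also have "\<dots> = f ((f ^^ Suc n) (bracket x v) + scale (of_nat (Suc n)) ((f ^^ n) (h v)))
        + (f ^^ Suc n) (h v)"
      by (simp only: Suc.IH fnh)
    also have "\<dots> = (f ^^ Suc (Suc n)) (bracket x v)
        + (scale (of_nat (Suc n)) ((f ^^ Suc n) (h v)) + scale 1 ((f ^^ Suc n) (h v)))"
      by (simp add: lin add.assoc)
    finally show ?case by (simp only: scale_left_distrib[symmetric] of_nat_Suc ac_simps)
  qed (simp add: xf)
  define n where "n = (LEAST n. \<forall>v. (f ^^ n) v = 0)"
  have ex: "\<exists>n. \<forall>v. (f ^^ n) v = 0" using f(2) by (simp add: nilpotent_op_def)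
  have n: "(f ^^ n) v = 0" for v using LeastI_ex[OF ex] unfolding n_def by blast
  obtain u :: 'a where "u \<noteq> 0" using UNIV_nonzero by blast
  then obtain m where m: "n = Suc m" using n[of u] by (cases n) auto
  have "(f ^^ m) v = 0" for v
  proof -
    have "scale (of_nat (Suc m)) ((f ^^ m) (h v)) = 0"
      using comm[of m v] n unfolding m by (simp add: bracket_right del: of_nat_Suc funpow.simps)
    then have "(f ^^ m) (h v) = 0" by (simp del: of_nat_Suc)
    then show ?thesis using inj fnh by simp
  qed
  then have "n \<le> m" unfolding n_def by (intro Least_le) blast
  then show False using m by simp
qed

text \<open>
  The vanishing of the supertrace of \<open>[ad x, f]\<close> does not decide this, since the identity can have
  supertrace zero as well. Put
  \<open>h v = [x, f v] + f [x, v]\<close> and \<open>u = f x\<close>. The rule for \<open>f [x, v]\<close> reads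
  \<open>[u, v] = 2 f [x, v] + [x, f v]\<close>, where \<open>f f = 0\<close>. For \<open>v = u\<close> it gives \<open>f [x, u] = 0\<close>, as \<open>u\<close> is
  even, and so \<open>h u = 0\<close>. If \<open>h\<close> is injective, then \<open>u = 0\<close>, and applying \<open>f\<close> to
  \<open>0 = 2 f [x, v] + [x, f v]\<close> yields \<open>h (f v) = 0\<close>. Hence \<open>f = 0\<close> and \<open>h = 0\<close>, which is absurd.
\<close>

lemma odd_supercommutator_not_injective:
  assumes x: "x \<in> gr 1" and f: "superderivation (1 / 2) 1 f"
  shows "\<exists>v. v \<noteq> 0 \<and> supercommutator 1 1 (bracket x) f v = 0"
proof (rule ccontr)
  define h where "h = supercommutator 1 1 (bracket x) f"
  assume "\<not> ?thesis"
  then have inj: "h v = 0 \<Longrightarrow> v = 0" for v unfolding h_def by blast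
  have h: "h v = bracket x (f v) + f (bracket x v)" for v
    by (simp add: h_def supercommutator_def)
  note lin = superderivation_linearD[OF f]
  have ff: "f (f v) = 0" for v
    using odd_square_zero half_superderivations_supercommute[OF f f] by blast
  have ad: "bracket (f x) v = scale 2 (f (bracket x v)) + bracket x (f v)" for v
    unfolding superderivation_bracket[OF f x] by (simp add: algebra_simps)
  have fx: "f x \<in> gr 0" using superderivation_gr[OF f x] by simp
  have "bracket (f x) (f x) = - bracket (f x) (f x)"
    using super_skew_symmetric[OF fx fx] by simp
  then have "scale 2 (bracket (f x) (f x)) = 0"
    using scale_left_distrib[of 1 1 "bracket (f x) (f x)"] by (simp add: eq_neg_iff_add_eq_0)
  then have "scale 2 (f (bracket x (f x))) = 0"
    using ad[of "f x"] by (simp add: ff bracket_right)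
  then have "f x = 0" using inj[of "f x"] by (simp add: h ff bracket_right)
  then have zero: "scale 2 (f (bracket x v)) + bracket x (f v) = 0" for v
    using ad[of v] by (simp add: bracket_left)
  have "f v = 0" for v
  proof (rule inj)
    have "f (scale 2 (f (bracket x v)) + bracket x (f v)) = 0" by (simp only: zero lin)
    then show "h (f v) = 0" by (simp add: h lin ff bracket_right)
  qed
  then have "v = 0" for v :: 'a using inj[of v] by (simp add: h bracket_right)
  then show False using UNIV_nonzero by blast
qed

text \<open>
  The family of all nilpotent superderivations with multiplier \<open>1/2\<close> supercommutes. It is stable
  under supercommutators \<open>h\<close> with \<open>ad x\<close>: an odd \<open>h\<close> has square zero, and an even \<open>h\<close> has a single
  eigenvalue, which is 0 because \<open>h\<close> is not injective.
\<close>

lemma nilpotent_half_superderivation_zero: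
  assumes "superderivation (1 / 2) p f" "nilpotent_op f"
  shows "f x = 0"
proof (rule stable_supercommuting_family_zero[where f = f and p = p
      and N = "\<lambda>p. {f. superderivation (1 / 2) p f \<and> nilpotent_op f}"])
  fix i q g x
  assume x: "x \<in> gr i" and "g \<in> {f. superderivation (1 / 2) q f \<and> nilpotent_op f}"
  then have g: "superderivation (1 / 2) q g" "nilpotent_op g" by auto
  let ?h = "supercommutator i q (bracket x) g"
  have h: "superderivation (1 / 2) (i + q) ?h"
    using superderivation_supercommutator[OF superderivation_ad[OF x] g(1)] by simp
  have "nilpotent_op ?h"
  proof (cases "i = q")
    case True
    then have h0: "superderivation (1 / 2) 0 ?h" using h by simp
    obtain a where a: "nilpotent_op (shift ?h a)" using half_superderivation_single_root[OF h0] by blast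
    have "\<exists>v. v \<noteq> 0 \<and> ?h v = 0"
      using even_commutator_not_injective odd_supercommutator_not_injective x g True by (cases i) auto
    then have "a = 0" using nilpotent_shift_injective[OF superderivation_linear[OF h] a] by blast
    then show ?thesis using a by (simp add: shift_0)
  next
    case False
    then have "i + q = 1" by (cases i; cases q) auto
    then have "superderivation (1 / 2) 1 ?h" using h by simp
    then show ?thesis
      using odd_square_zero half_superderivations_supercommute by (intro nilpotent_op_square_zero) blast
  qed
  then show "?h \<in> {f. superderivation (1 / 2) (i + q) f \<and> nilpotent_op f}" using h by simp
qed (use assms half_superderivations_supercommute in auto)

lemma odd_half_superderivation_zero:
  assumes "superderivation (1 / 2) 1 f"
  shows "f x = 0"
proof (rule nilpotent_half_superderivation_zero[OF assms])
  show "nilpotent_op f"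
    using odd_square_zero half_superderivations_supercommute[OF assms assms]
    by (intro nilpotent_op_square_zero) blast
qed

lemma even_half_superderivation_scalar:
  assumes f: "superderivation (1 / 2) 0 f"
  shows "\<exists>a. \<forall>x. f x = scale a x"
proof -
  obtain a where a: "nilpotent_op (shift f a)" using half_superderivation_single_root[OF f] by blast
  have "superderivation (1 / 2) 0 (shift f a)"
  proof (rule superderivationI)
    show "linear_op (shift f a)" by (rule linear_op_shift[OF superderivation_linear[OF f]])
    show "shift f a x \<in> gr (i + 0)" if "x \<in> gr i" for i x
      unfolding shift_def using superderivation_even_gr[OF f that] that
      by (auto intro: subspace_diff[OF subspace_gr] subspace_scale[OF subspace_gr])
    show "shift f a (bracket x y)
        = scale (1 / 2) (bracket (shift f a x) y + scale (super_sign 0 i) (bracket x (shift f a y)))" for i x y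
    proof -
      have "scale (a / 2) (bracket x y) + scale (a / 2) (bracket x y) = scale a (bracket x y)"
        by (simp flip: scale_left_distrib)
      then show ?thesis
        unfolding shift_def superderivation_even_bracket[OF f]
        by (simp add: bracket_left bracket_right scale_right_distrib scale_right_diff_distrib
            algebra_simps del: scale_left_distrib)
    qed
  qed
  then have "shift f a x = 0" for x using nilpotent_half_superderivation_zero a by blast
  then show ?thesis by (auto simp: shift_def)
qed

section \<open>Transposed Poisson structures\<close>

lemma superderivation_dot:
  assumes "transposed_poisson_superalgebra scale gr bracket dot" and z: "z \<in> gr k"
  shows "superderivation (1 / 2) k (dot z)"
proof -
  interpret T: transposed_poisson_superalgebra scale gr bracket dot by (fact assms)
  show ?thesis
  proof (rule superderivationI)
    show "linear_op (dot z)" by (rule T.dot.linear_right)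
    show "dot z x \<in> gr (i + k)" if "x \<in> gr i" for i x
      using T.dot.mult_gr[OF z that] by (simp only: add.commute)
    fix i j x y assume "x \<in> gr i" "y \<in> gr j"
    from T.transposed_leibniz[OF this z]
    have "scale (1 / 2) (scale 2 (dot z (bracket x y)))
        = scale (1 / 2) (bracket (dot z x) y + scale (super_sign k i) (bracket x (dot z y)))"
      by (simp only: super_sign_commute)
    then show "dot z (bracket x y)
        = scale (1 / 2) (bracket (dot z x) y + scale (super_sign k i) (bracket x (dot z y)))"
      by simp
  qed
qed

text \<open>
  Odd elements multiply by zero, and an even \<open>z\<close> multiplies by a scalar \<open>l z\<close>. If \<open>l z \<noteq> 0\<close>, then
  \<open>l z w = z w = \<plusminus> w z\<close> shows that odd \<open>w\<close> vanish and that every even \<open>w\<close> is a multiple of \<open>z\<close>. The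
  algebra would be spanned by \<open>z\<close>, where \<open>[z, z] = 0\<close>.
\<close>

lemma transposed_poisson_product_zero:
  assumes "transposed_poisson_superalgebra scale gr bracket dot"
  shows "dot x y = 0"
proof -
  interpret T: transposed_poisson_superalgebra scale gr bracket dot by (fact assms)
  note dot_left = linear_opD[OF T.dot.linear_left] and dot_right = linear_opD[OF T.dot.linear_right]
  have odd: "dot z w = 0" if "z \<in> gr 1" for z w
    using odd_half_superderivation_zero[OF superderivation_dot[OF assms that]] .
  have "\<forall>z\<in>gr 0. \<exists>a. \<forall>w. dot z w = scale a w"
    using even_half_superderivation_scalar superderivation_dot[OF assms] by blast
  then obtain l where l: "\<And>z w. z \<in> gr 0 \<Longrightarrow> dot z w = scale (l z) w" by metis
  have "l z = 0" if z: "z \<in> gr 0" for z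
  proof (rule ccontr)
    assume lz: "l z \<noteq> 0"
    have "w = 0" if w: "w \<in> gr 1" for w
      using T.dot.supercommutative[OF z w] odd[OF w] l[OF z, of w] lz by simp
    then have all_even: "w \<in> gr 0" for w
      using homogeneous_sum[of w] by (metis add.right_neutral)
    have "w = scale (l w / l z) z" for w
    proof -
      have "scale (l z) w = scale (l w) z"
        using T.dot.supercommutative[OF z all_even[of w]] l[OF z, of w] l[OF all_even[of w], of z] by simp
      then have "scale (1 / l z) (scale (l z) w) = scale (1 / l z) (scale (l w) z)" by simp
      then show ?thesis using lz by simp
    qed
    moreover have "bracket z z = 0"
    proof -
      have "scale 2 (bracket z z) = 0"
        using super_skew_symmetric[OF z z] scale_left_distrib[of 1 1 "bracket z z"]
        by (simp add: eq_neg_iff_add_eq_0)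
      then show ?thesis by simp
    qed
    ultimately have "bracket v w = 0" for v w
      using bracket_left(2) bracket_right(2) by (metis scale_zero_right)
    then show False using not_abelian by blast
  qed
  then have even: "dot z w = 0" if "z \<in> gr 0" for z w using l that by simp
  obtain x0 x1 where "x0 \<in> gr 0" "x1 \<in> gr 1" "x = x0 + x1" by (rule homogeneous_sum)
  then show ?thesis using odd even by (simp add: dot_left)
qed

end

theorem corollary12:
  fixes scale :: "complex \<Rightarrow> 'a::ab_group_add \<Rightarrow> 'a"
    and Basis :: "'a set"
    and gr :: "bit \<Rightarrow> 'a set"
    and bracket :: "'a \<Rightarrow> 'a \<Rightarrow> 'a"
  assumes "finite_dimensional_vector_space scale Basis"
    and "simple_lie_superalgebra scale gr bracket"
  shows "\<not> (\<exists>dot. transposed_poisson_superalgebra scale gr bracket dot \<and>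
               nontrivial_structure bracket dot)"
proof -
  interpret fd_simple_lie_superalgebra scale Basis gr bracket
    using assms by (simp add: fd_simple_lie_superalgebra_def complex_fd_space_def)
  show ?thesis
    using transposed_poisson_product_zero unfolding nontrivial_structure_def by blast
qed

end
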